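(* Assume that $\mathrm{cov}(\mathcal{M})=\mathfrak{c}$. Then there is a Menger totally imperfect set $X$ (a subset of $2^\omega$ or of $2^\omega\times 2^\omega$) which does not satisfy $\mathsf{S}_1(\Gamma,\mathrm{O})$.
   Context: $2^\omega$ is the Cantor space. $\mathfrak{c}$ is the cardinality of the continuum; $\mathrm{cov}(\mathcal{M})$ is the minimal cardinality of a family of meager subsets of $2^\omega$ which covers $2^\omega$. A set $X$ is Menger if for every sequence $\mathcal{U}_0,\mathcal{U}_1,\dots$ of open covers of $X$ there are finite sets $\mathcal{F}_0\subseteq\mathcal{U}_0,\mathcal{F}_1\subseteq\mathcal{U}_1,\dots$ such that the family $\{\bigcup\mathcal{F}_n: n\in\omega\}$ covers $X$. A family $\{V_n: n\in\omega\}$ of sets is a $\gamma$-cover of $X$ if for every $x\in X$ the set $\{n\in\omega: x\in V_n\}$ is cofinite. A set $X$ satisfies $\mathsf{S}_1(\Gamma,\mathrm{O})$ if for every sequence $\mathcal{U}_0,\mathcal{U}_1,\dots$ of open $\gamma$-covers of $X$ there are sets $U_0\in\mathcal{U}_0,U_1\in\mathcal{U}_1,\dots$ such that the family $\{U_n: n\in\omega\}$ covers $X$. A set is totally imperfect if it contains no perfect subset, i.e. no homeomorphic copy of $2^\omega$. *)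

theory Defs
  imports "HOL-Analysis.Analysis"
begin

unbundle cardinal_syntax

text \<open>The type \<open>bool\<close> is discrete and function types carry the product topology, so this is
  the Cantor space \<open>2\<^sup>\<omega>\<close>.\<close>

type_synonym cantor = "nat \<Rightarrow> bool"

subsection \<open>Meager sets and the covering number\<close>

definition nowhere_dense :: "'a::topological_space set \<Rightarrow> bool" where
  "nowhere_dense A \<longleftrightarrow> interior (closure A) = {}"

definition meager :: "'a::topological_space set \<Rightarrow> bool" where
  "meager A \<longleftrightarrow> (\<exists>N :: nat \<Rightarrow> 'a set. (\<forall>n. nowhere_dense (N n)) \<and> A = (\<Union>n. N n))"

definition meager_covering :: "cantor set set \<Rightarrow> bool" where
  "meager_covering \<A> \<longleftrightarrow> (\<forall>A\<in>\<A>. meager A) \<and> \<Union>\<A> = UNIV"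

text \<open>Cardinals are represented by cardinal orders and are unique only up to \<open>=o\<close>; the choice
  of a least one is therefore immaterial. That it exists is \<open>cov_meager_least\<close> below.\<close>

definition cov_meager :: "cantor set rel" where
  "cov_meager = (SOME \<kappa>. \<kappa> \<in> {|\<A>| |\<A>. meager_covering \<A>} \<and>
     (\<forall>\<kappa>'\<in>{|\<A>| |\<A>. meager_covering \<A>}. \<kappa> \<le>o \<kappa>'))"

definition continuum :: "real rel" where
  "continuum = |UNIV :: real set|"

subsection \<open>Covering properties\<close>

text \<open>Covers of a set \<open>X\<close> consist of open sets of the ambient space, as in the library's
  treatment of compactness; intersecting with \<open>X\<close> gives the covers by relatively open sets.\<close>

definition open_cover :: "'a::topological_space set \<Rightarrow> 'a set set \<Rightarrow> bool" where
  "open_cover X \<U> \<longleftrightarrow> (\<forall>U\<in>\<U>. open U) \<and> X \<subseteq> \<Union>\<U>"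

definition Menger :: "'a::topological_space set \<Rightarrow> bool" where
  "Menger X \<longleftrightarrow> (\<forall>\<U> :: nat \<Rightarrow> 'a set set. (\<forall>n. open_cover X (\<U> n)) \<longrightarrow>
     (\<exists>\<F>. (\<forall>n. finite (\<F> n) \<and> \<F> n \<subseteq> \<U> n) \<and> X \<subseteq> (\<Union>n. \<Union>(\<F> n))))"

text \<open>The enumeration \<open>V\<close> may have repetitions.\<close>

definition gamma_cover :: "'a set \<Rightarrow> 'a set set \<Rightarrow> bool" where
  "gamma_cover X \<V> \<longleftrightarrow> (\<exists>V :: nat \<Rightarrow> 'a set. \<V> = range V \<and> (\<forall>x\<in>X. finite (- {n. x \<in> V n})))"

definition open_gamma_cover :: "'a::topological_space set \<Rightarrow> 'a set set \<Rightarrow> bool" where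
  "open_gamma_cover X \<V> \<longleftrightarrow> gamma_cover X \<V> \<and> (\<forall>U\<in>\<V>. open U)"

definition S1_Gamma_O :: "'a::topological_space set \<Rightarrow> bool" where
  "S1_Gamma_O X \<longleftrightarrow> (\<forall>\<U> :: nat \<Rightarrow> 'a set set. (\<forall>n. open_gamma_cover X (\<U> n)) \<longrightarrow>
     (\<exists>U. (\<forall>n. U n \<in> \<U> n) \<and> X \<subseteq> (\<Union>n. U n)))"

definition totally_imperfect :: "'a::topological_space set \<Rightarrow> bool" where
  "totally_imperfect X \<longleftrightarrow> \<not> (\<exists>P\<subseteq>X. P homeomorphic (UNIV :: cantor set))"

subsection \<open>Well-definedness of the covering number\<close>

lemma open_cantor_singleton: "\<not> open {x :: cantor}"
proof
  assume "open {x}"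
  then have "openin (product_topology (\<lambda>i::nat. euclidean::bool topology) UNIV) {x}"
    by (simp add: open_fun_def)
  from product_topology_open_contains_basis[OF this, of x]
  obtain U where U: "finite {i. U i \<noteq> (UNIV :: bool set)}"
    "x \<in> Pi\<^sub>E UNIV U" "Pi\<^sub>E UNIV U \<subseteq> {x}"
    by auto
  then obtain i where i: "U i = UNIV"
    using ex_new_if_finite[OF infinite_UNIV_nat U(1)] by auto
  have "x(i := \<not> x i) \<in> Pi\<^sub>E UNIV U"
    using U(2) i by (auto simp: PiE_iff)
  then have "x(i := \<not> x i) = x" using U(3) by blast
  then show False by (metis fun_upd_same)
qed

lemma meager_covering_singletons: "meager_covering (range (\<lambda>x. {x}))"
proof -
  have "nowhere_dense {x}" for x :: cantor
  proof -
    have "interior {x} \<noteq> {x}" using open_cantor_singleton[of x] by (metis open_interior)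
    then have "interior {x} = {}" using interior_subset[of "{x}"] by blast
    moreover have "closed {x}"
    proof -
      have "closed {y :: cantor. y i = x i}" for i
        by (intro closed_Collect_eq continuous_on_product_coordinates continuous_on_const)
      then have "closed (\<Inter>i. {y :: cantor. y i = x i})" by (intro closed_INT) blast
      moreover have "(\<Inter>i. {y :: cantor. y i = x i}) = {x}" by auto
      ultimately show ?thesis by simp
    qed
    ultimately show ?thesis by (simp add: nowhere_dense_def closure_closed)
  qed
  then have "meager {x}" for x :: cantor
    unfolding meager_def by (intro exI[of _ "\<lambda>_. {x}"]) auto
  then show ?thesis by (auto simp: meager_covering_def)
qed

lemma cov_meager_least:
  shows "\<exists>\<A>. meager_covering \<A> \<and> cov_meager = |\<A>|"
    and "meager_covering \<A> \<Longrightarrow> cov_meager \<le>o |\<A>|"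
proof -
  let ?R = "{|\<A>| |\<A>. meager_covering \<A>}"
  have "?R \<noteq> {}" using meager_covering_singletons by blast
  moreover have "\<forall>r\<in>?R. Card_order r" using card_of_Card_order by blast
  ultimately have "\<exists>\<kappa>. \<kappa> \<in> ?R \<and> (\<forall>\<kappa>'\<in>?R. \<kappa> \<le>o \<kappa>')"
    using exists_minim_Card_order[of ?R] by blast
  then have *: "cov_meager \<in> ?R \<and> (\<forall>\<kappa>'\<in>?R. cov_meager \<le>o \<kappa>')"
    unfolding cov_meager_def by (rule someI_ex)
  show "\<exists>\<A>. meager_covering \<A> \<and> cov_meager = |\<A>|" using * by blast
  show "meager_covering \<A> \<Longrightarrow> cov_meager \<le>o |\<A>|" using * by blast
qed

end

theory Submission
  imports Defs
begin

text \<open>Call a closed subset of \<open>2\<^sup>\<omega> \<times> 2\<^sup>\<omega>\<close> thin if all its vertical fibres are nowhere dense. There are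
  only \<open>c\<close> closed sets, so enumerate them and well-order \<open>2\<^sup>\<omega>\<close> in type \<open>c\<close>; since \<open>cov(M) = c\<close>, one
  can choose over each \<open>x\<close> a countable dense set \<open>D\<^sub>x\<close> that misses the fibres of all thin sets with index
  at most \<open>x\<close>. The union \<open>X\<close> of the sets \<open>{x} \<times> D\<^sub>x\<close> meets every thin set in fewer than \<open>cov(M)\<close> points.

  Given open covers of \<open>X\<close>, density of the fibres and compactness of \<open>2\<^sup>\<omega>\<close> yield finite subfamilies of
  the even-numbered covers whose union has a thin complement; the fewer than \<open>cov(M)\<close> points of \<open>X\<close> in
  that complement are covered using the odd-numbered covers. A perfect subset of \<open>X\<close> would be thin,
  because its fibres are countable, and hence too small. Finally, \<open>X\<close> projects onto \<open>2\<^sup>\<omega>\<close>, which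
  does not satisfy \<open>S\<^sub>1(\<Gamma>, O)\<close>, as witnessed by clopen \<open>\<gamma>\<close>-covers, and these can be pulled back to \<open>X\<close>.\<close>

section \<open>Topology and cardinality of the Cantor space\<close>

text \<open>Through the instances for functions and products this makes \<open>cantor\<close> and
  \<open>cantor \<times> cantor\<close> second countable, as the Lindelof argument and the coding of
  closed sets require.\<close>

instance bool :: second_countable_topology
proof
  have "open = generate_topology (UNIV :: bool set set)"
    by (auto simp: open_discrete fun_eq_iff intro: generate_topology.Basis)
  then show "\<exists>B :: bool set set. countable B \<and> open = generate_topology B"
    by (intro exI[of _ UNIV]) (simp add: countable_finite)
qed

text \<open>Stems are lists because \<open>bool list\<close> is a countable type: the cylinders then
  form a countable base indexed by it.\<close>

definition cylinder :: "bool list \<Rightarrow> cantor set" where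
  "cylinder l = {y. \<forall>i<length l. y i = l ! i}"

text \<open>A homeomorphism of the whole space onto \<open>cylinder l\<close>; it transfers
  statements about the covering number to single cylinders.\<close>

definition prepend :: "bool list \<Rightarrow> cantor \<Rightarrow> cantor" where
  "prepend l x = (\<lambda>i. if i < length l then l ! i else x (i - length l))"

lemma prepend_in_cylinder: "prepend l x \<in> cylinder l"
  by (simp add: prepend_def cylinder_def)

lemma inj_prepend: "inj (prepend l)"
proof (rule injI)
  fix x y assume "prepend l x = prepend l y"
  then have "prepend l x (i + length l) = prepend l y (i + length l)" for i by simp
  then show "x = y" by (auto simp: prepend_def)
qed

lemma prepend_image_cylinder: "prepend l ` cylinder m = cylinder (l @ m)"
proof (intro equalityI subsetI)
  fix y assume y: "y \<in> cylinder (l @ m)"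
  have "prepend l (\<lambda>i. y (i + length l)) = y"
    using y by (auto simp: prepend_def cylinder_def nth_append)
  moreover have "(\<lambda>i. y (i + length l)) \<in> cylinder m"
    using y by (auto simp: cylinder_def nth_append)
  ultimately show "y \<in> prepend l ` cylinder m" by (metis imageI)
qed (auto simp: prepend_def cylinder_def nth_append)

lemma continuous_on_prepend: "continuous_on UNIV (prepend l)"
proof (rule continuous_on_coordinatewise_then_product)
  show "continuous_on UNIV (\<lambda>x. prepend l x i)" for i
    by (cases "i < length l") (simp_all add: prepend_def)
qed

lemma clopen_coordinate: "open {y :: cantor. y i = b}" "closed {y :: cantor. y i = b}"
proof -
  have "{y :: cantor. y i = b} = (\<lambda>y. y i) -` {b}" by auto
  moreover have "open ((\<lambda>y :: cantor. y i) -` {b})" "closed ((\<lambda>y :: cantor. y i) -` {b})"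
    by (auto intro!: open_vimage closed_vimage open_discrete finite_imp_closed
        continuous_on_product_coordinates)
  ultimately show "open {y :: cantor. y i = b}" "closed {y :: cantor. y i = b}" by simp_all
qed

lemma open_cylinder: "open (cylinder l)"
proof -
  have "cylinder l = (\<Inter>i\<in>{..<length l}. {y. y i = l ! i})"
    by (auto simp: cylinder_def)
  then show ?thesis by (auto intro!: open_INT clopen_coordinate)
qed

lemma open_contains_cylinder:
  assumes "open U" "(z :: cantor) \<in> U"
  obtains l where "z \<in> cylinder l" "cylinder l \<subseteq> U"
proof -
  have "openin (product_topology (\<lambda>i::nat. euclidean::bool topology) UNIV) U"
    using assms by (simp add: open_fun_def)
  from product_topology_open_contains_basis[OF this assms(2)]
  obtain V where V: "finite {i. V i \<noteq> (UNIV :: bool set)}"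
    "z \<in> Pi\<^sub>E UNIV V" "Pi\<^sub>E UNIV V \<subseteq> U"
    by auto
  obtain k where k: "\<And>i. V i \<noteq> UNIV \<Longrightarrow> i < k"
    using finite_nat_set_iff_bounded[of "{i. V i \<noteq> UNIV}"] V(1) by auto
  have "cylinder (map z [0..<k]) \<subseteq> Pi\<^sub>E UNIV V"
  proof
    fix y assume y: "y \<in> cylinder (map z [0..<k])"
    have "y i \<in> V i" for i
    proof (cases "V i = UNIV")
      case False
      then have "y i = z i" using y k by (auto simp: cylinder_def)
      then show ?thesis using V(2) by auto
    qed auto
    then show "y \<in> Pi\<^sub>E UNIV V" by auto
  qed
  then show ?thesis using V(3) by (intro that[of "map z [0..<k]"]) (auto simp: cylinder_def)
qed

lemma interior_eq_empty_cylinder: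
  "interior A = {} \<longleftrightarrow> (\<forall>l. \<exists>y\<in>cylinder l. y \<notin> A)"
proof
  assume "interior A = {}"
  then have "\<not> cylinder l \<subseteq> A" for l
    using interior_maximal[OF _ open_cylinder] prepend_in_cylinder by blast
  then show "\<forall>l. \<exists>y\<in>cylinder l. y \<notin> A" by blast
next
  assume *: "\<forall>l. \<exists>y\<in>cylinder l. y \<notin> A"
  show "interior A = {}"
  proof (rule ccontr)
    assume "interior A \<noteq> {}"
    then obtain z where "z \<in> interior A" by blast
    then obtain l where "cylinder l \<subseteq> interior A"
      using open_contains_cylinder[OF open_interior] by metis
    then show False using * interior_subset[of A] by blast
  qed
qed

lemma compact_UNIV_cantor: "compact (UNIV :: cantor set)"
proof -
  have "compact_space (product_topology (\<lambda>i::nat. euclidean::bool topology) UNIV)"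
    unfolding compact_space_product_topology
    by (auto simp: compact_space_def finite_imp_compact)
  then have "compact_space (euclidean :: cantor topology)"
    by (simp add: euclidean_product_topology)
  then show ?thesis by (simp add: compact_space_def)
qed

text \<open>Serves to conclude that a copy of the Cantor space in the product, being compact, is
  closed.\<close>

lemma Hausdorff_cantor_times_cantor: "Hausdorff_space (euclidean :: (cantor \<times> cantor) topology)"
proof -
  have "Hausdorff_space (euclidean :: bool topology)"
    unfolding Hausdorff_space_def
  proof (intro allI impI)
    fix x y :: bool
    assume "x \<in> topspace euclidean \<and> y \<in> topspace euclidean \<and> x \<noteq> y"
    then show "\<exists>U V. openin euclidean U \<and> openin euclidean V \<and> x \<in> U \<and> y \<in> V \<and> disjnt U V"
      by (intro exI[of _ "{x}"] exI[of _ "{y}"]) (simp add: open_discrete)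
  qed
  then have "Hausdorff_space (product_topology (\<lambda>i::nat. euclidean::bool topology) UNIV)"
    by (simp add: Hausdorff_space_product_topology)
  then have "Hausdorff_space (euclidean :: cantor topology)"
    by (simp add: euclidean_product_topology)
  then show ?thesis
    unfolding prod_topology_euclidean[symmetric] Hausdorff_space_prod_topology by blast
qed

text \<open>\<open>prepend l\<close> injects the whole space into the cylinder, and characteristic
  functions inject the power set of the naturals into the space.\<close>

lemma uncountable_cylinder: "uncountable (cylinder l)"
proof
  assume "countable (cylinder l)"
  then have "countable (prepend l ` UNIV)"
    using prepend_in_cylinder by (metis countable_subset image_subsetI)
  then have "countable (UNIV :: cantor set)"
    using countable_image_inj_eq[OF inj_prepend] by blast
  moreover have "inj (\<lambda>S n. (n :: nat) \<in> S)" by (auto intro!: injI simp: fun_eq_iff)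
  ultimately have "countable (UNIV :: nat set set)"
    by (meson countable_image_inj_on countable_subset subset_UNIV)
  moreover have "(UNIV :: nat set set) \<approx> (UNIV :: real set)" by (rule nat_sets_eqpoll_reals)
  ultimately show False using uncountable_UNIV_real by (metis countable_eqpoll eqpoll_sym)
qed

lemma card_cantor_ordLeq_continuum: "|UNIV :: cantor set| \<le>o continuum"
proof -
  obtain f :: "nat set \<Rightarrow> real" where f: "inj f"
    using nat_sets_eqpoll_reals unfolding eqpoll_def bij_betw_def by blast
  have "inj (\<lambda>x :: cantor. f (Collect x))"
    using f by (auto intro!: injI dest: injD)
  then show ?thesis
    unfolding continuum_def card_of_ordLeq[symmetric] by blast
qed

section \<open>The covering number localized to cylinders\<close>

text \<open>The singletons are a covering by meager sets. With
  \<open>card_cantor_ordLeq_continuum\<close>, the hypothesis of the theorem forces cov(M), the size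
  of \<open>cantor\<close> and the continuum to coincide.\<close>

lemma cov_meager_ordLeq_cantor: "cov_meager \<le>o |UNIV :: cantor set|"
  using cov_meager_least(2)[OF meager_covering_singletons] card_of_image ordLeq_transitive by blast

lemma nowhere_dense_meager: "nowhere_dense A \<Longrightarrow> meager A"
  unfolding meager_def by (intro exI[of _ "\<lambda>_. A"]) auto

text \<open>Pulled back along \<open>prepend l\<close>, sets covering one cylinder would become
  equally few nowhere dense sets covering the whole space.\<close>

lemma cylinder_not_covered:
  fixes M :: "'i \<Rightarrow> cantor set"
  assumes I: "|I| <o cov_meager"
    and M: "\<And>i. i \<in> I \<Longrightarrow> closed (M i) \<and> interior (M i) = {}"
  shows "\<exists>y\<in>cylinder l. \<forall>i\<in>I. y \<notin> M i"
proof -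
  define P where "P i = prepend l -` M i" for i
  have nd: "nowhere_dense (P i)" if i: "i \<in> I" for i
  proof -
    have "closed (P i)"
      unfolding P_def using M[OF i] continuous_on_prepend by (intro closed_vimage) auto
    moreover have "interior (P i) = {}"
      unfolding interior_eq_empty_cylinder
    proof
      fix m
      obtain y where "y \<in> cylinder (l @ m)" "y \<notin> M i"
        using M[OF i] interior_eq_empty_cylinder by blast
      then show "\<exists>y\<in>cylinder m. y \<notin> P i"
        unfolding prepend_image_cylinder[symmetric] P_def by auto
    qed
    ultimately show ?thesis by (simp add: nowhere_dense_def)
  qed
  have "\<Union>(P ` I) \<noteq> UNIV"
  proof
    assume "\<Union>(P ` I) = UNIV"
    then have "meager_covering (P ` I)"
      using nd nowhere_dense_meager by (auto simp: meager_covering_def)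
    then have "cov_meager \<le>o |P ` I|" by (rule cov_meager_least(2))
    then have "cov_meager \<le>o |I|" using card_of_image ordLeq_transitive by blast
    then show False using I not_ordLess_ordLeq by blast
  qed
  then obtain x where "x \<notin> \<Union>(P ` I)" by blast
  then have "\<forall>i\<in>I. prepend l x \<notin> M i" by (auto simp: P_def)
  then show ?thesis using prepend_in_cylinder by blast
qed

section \<open>Coding selections by matrices; small sets are Menger\<close>

text \<open>Viewing a point of the Cantor space as a matrix, \<open>first_true n m\<close> is the set of those whose
  \<open>n\<close>-th row has its first true entry in column \<open>m\<close>.\<close>

definition first_true :: "nat \<Rightarrow> nat \<Rightarrow> cantor set" where
  "first_true n m = {c. c (prod_encode (n, m)) \<and> (\<forall>j<m. \<not> c (prod_encode (n, j)))}"

lemma first_true_unique: "c \<in> first_true n m \<Longrightarrow> c \<in> first_true n m' \<Longrightarrow> m = m'"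
  unfolding first_true_def by (metis (mono_tags, lifting) linorder_neqE_nat mem_Collect_eq)

lemma finite_first_true: "finite {m. c \<in> first_true n m}"
proof (cases "\<exists>m. c \<in> first_true n m")
  case True
  then obtain m where "c \<in> first_true n m" by blast
  then have "{m. c \<in> first_true n m} = {m}" using first_true_unique by blast
  then show ?thesis by simp
qed simp

lemma clopen_first_true: "open (first_true n m)" "closed (first_true n m)"
proof -
  have *: "first_true n m = {c. c (prod_encode (n, m)) = True} \<inter>
      (\<Inter>j\<in>{..<m}. {c. c (prod_encode (n, j)) = False})"
    by (auto simp: first_true_def)
  show "open (first_true n m)" "closed (first_true n m)"
    unfolding * by (intro open_Int closed_Int open_INT closed_INT ballI
        clopen_coordinate finite_lessThan)+
qed

text \<open>Rows can be prescribed independently; the witness has exactly one true entry in row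
  \<open>n\<close>, in column \<open>h n\<close>.\<close>

lemma ex_all_first_true: "\<exists>c. \<forall>n. c \<in> first_true n (h n)"
  by (rule exI[of _ "\<lambda>i. snd (prod_decode i) = h (fst (prod_decode i))"])
    (auto simp: first_true_def)

lemma no_first_true_nowhere_dense:
  "closed {c. \<forall>n. c \<notin> first_true n (h n)}" "interior {c. \<forall>n. c \<notin> first_true n (h n)} = {}"
proof -
  have "{c. \<forall>n. c \<notin> first_true n (h n)} = (\<Inter>n. - first_true n (h n))" by auto
  then show "closed {c. \<forall>n. c \<notin> first_true n (h n)}"
    using clopen_first_true by (auto intro!: closed_INT)
  show "interior {c. \<forall>n. c \<notin> first_true n (h n)} = {}"
    unfolding interior_eq_empty_cylinder
  proof
    fix l :: "bool list"
    let ?k = "length l"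
    \<comment> \<open>Row \<open>?k\<close> lies entirely beyond the stem, because
      \<open>prod_encode (?k, j) \<ge> ?k\<close>; its only true entry is put in column
      \<open>h ?k\<close>.\<close>
    define c :: cantor where "c i = (if i < ?k then l ! i else (i = prod_encode (?k, h ?k)))" for i
    have "\<not> prod_encode (?k, j) < ?k" for j
      using le_prod_encode_1[of ?k j] by linarith
    then have "c \<in> first_true ?k (h ?k)" by (auto simp: first_true_def c_def)
    moreover have "c \<in> cylinder l" by (simp add: c_def cylinder_def)
    ultimately show "\<exists>c\<in>cylinder l. c \<notin> {c. \<forall>n. c \<notin> first_true n (h n)}" by blast
  qed
qed

text \<open>Each point \<open>z\<close> yields a function \<open>h z\<close> of indices of sets
  containing it. A single \<open>c\<close> that agrees with every \<open>h z\<close> in some row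
  then selects at most one member of each cover.\<close>

lemma small_imp_Menger:
  fixes Z :: "'a::second_countable_topology set"
  assumes Z: "|Z| <o cov_meager"
  shows "Menger Z"
  unfolding Menger_def
proof (intro allI impI)
  fix \<U> :: "nat \<Rightarrow> 'a set set"
  assume cov: "\<forall>n. open_cover Z (\<U> n)"
  have "\<exists>\<V>. \<V> \<subseteq> \<U> n \<and> countable \<V> \<and> \<Union>\<V> = \<Union>(\<U> n)" for n
    using Lindelof[of "\<U> n"] cov unfolding open_cover_def by metis
  then obtain \<V> where \<V>: "\<And>n. \<V> n \<subseteq> \<U> n" "\<And>n. countable (\<V> n)" "\<And>n. \<Union>(\<V> n) = \<Union>(\<U> n)"
    by metis
  have "\<exists>m. z \<in> from_nat_into (\<V> n) m \<and> from_nat_into (\<V> n) m \<in> \<V> n" if "z \<in> Z" for z n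
  proof -
    have "z \<in> \<Union>(\<V> n)" using cov that \<V>(3) unfolding open_cover_def by blast
    then obtain V where "V \<in> \<V> n" "z \<in> V" by blast
    then show ?thesis by (metis \<V>(2) from_nat_into_to_nat_on)
  qed
  then obtain h where h: "\<And>z n. z \<in> Z \<Longrightarrow> z \<in> from_nat_into (\<V> n) (h z n) \<and>
      from_nat_into (\<V> n) (h z n) \<in> \<V> n"
    by metis
  \<comment> \<open>\<open>cylinder []\<close> is the whole space; the sets to avoid consist of the
    \<open>c\<close> that disagree with \<open>h z\<close> in every row.\<close>
  have "\<exists>c\<in>cylinder []. \<forall>z\<in>Z. c \<notin> {c. \<forall>n. c \<notin> first_true n (h z n)}"
    by (rule cylinder_not_covered[OF Z]) (intro conjI no_first_true_nowhere_dense)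
  then obtain c where c: "\<And>z. z \<in> Z \<Longrightarrow> \<exists>n. c \<in> first_true n (h z n)" by auto
  \<comment> \<open>The intersection discards the arbitrary value that \<open>from_nat_into\<close>
    takes when \<open>\<V> n\<close> is empty.\<close>
  define \<F> where "\<F> n = \<V> n \<inter> from_nat_into (\<V> n) ` {m. c \<in> first_true n m}" for n
  have "finite (\<F> n)" for n
    unfolding \<F>_def using finite_first_true by blast
  moreover have "\<F> n \<subseteq> \<U> n" for n using \<V>(1) by (auto simp: \<F>_def)
  moreover have "Z \<subseteq> (\<Union>n. \<Union>(\<F> n))"
  proof
    fix z assume z: "z \<in> Z"
    then obtain n where "c \<in> first_true n (h z n)" using c by blast
    then have "from_nat_into (\<V> n) (h z n) \<in> \<F> n" using h[OF z] by (auto simp: \<F>_def)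
    then show "z \<in> (\<Union>n. \<Union>(\<F> n))" using h[OF z] by blast
  qed
  ultimately show "\<exists>\<F>. (\<forall>n. finite (\<F> n) \<and> \<F> n \<subseteq> \<U> n) \<and> Z \<subseteq> (\<Union>n. \<Union>(\<F> n))" by blast
qed

section \<open>Construction of a set with small traces on thin sets\<close>

text \<open>A closed set is coded by a subfamily of a countable base whose union is its complement,
  and such a subfamily by a point of \<open>cantor\<close>.\<close>

lemma closed_sets_enumeration:
  "\<exists>N :: cantor \<Rightarrow> 'a::second_countable_topology set. \<forall>F. closed F \<longrightarrow> F \<in> range N"
proof -
  obtain B :: "'a set set" where B: "countable B" "topological_basis B"
    using ex_countable_basis by blast
  define N where "N a = - \<Union>{U \<in> B. a (to_nat_on B U)}" for a :: cantor
  have "F \<in> range N" if F: "closed F" for F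
  proof -
    obtain B' where B': "B' \<subseteq> B" "\<Union>B' = - F"
      using B(2) F unfolding topological_basis_def by (meson open_Compl)
    have "{U \<in> B. to_nat_on B U \<in> to_nat_on B ` B'} = B'"
      using B'(1) inj_on_to_nat_on[OF B(1)] by (auto simp: inj_on_def)
    then have "N (\<lambda>i. i \<in> to_nat_on B ` B') = F" unfolding N_def using B'(2) by simp
    then show ?thesis by blast
  qed
  then show ?thesis by blast
qed

definition thin :: "(cantor \<times> cantor) set \<Rightarrow> bool" where
  "thin N \<longleftrightarrow> closed N \<and> (\<forall>x. interior (Pair x -` N) = {})"

lemma thin_fibre: "thin N \<Longrightarrow> closed (Pair x -` N) \<and> interior (Pair x -` N) = {}"
  unfolding thin_def by (auto intro!: closed_vimage continuous_intros)

text \<open>Passes from few fibres to few points, as each fibre contributes only countably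
  many.\<close>

lemma times_bool_lists_ordLess_cantor:
  assumes "|A| <o |UNIV :: cantor set|"
  shows "|A \<times> (UNIV :: bool list set)| <o |UNIV :: cantor set|"
proof (cases "finite A")
  case True
  then have "countable (A \<times> (UNIV :: bool list set))" by (simp add: countable_finite)
  moreover have "uncountable (UNIV :: cantor set)"
    using uncountable_cylinder[of "[]"] by (simp add: cylinder_def)
  ultimately have "\<nexists>f. inj_on f (UNIV :: cantor set) \<and> f ` UNIV \<subseteq> A \<times> (UNIV :: bool list set)"
    by (meson countable_image_inj_on countable_subset)
  then show ?thesis by (simp only: card_of_ordLess)
next
  case False
  have "|UNIV :: bool list set| \<le>o |UNIV :: nat set|"
    unfolding card_of_ordLeq[symmetric] using inj_to_nat by blast
  then have "|UNIV :: bool list set| \<le>o |A|"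
    using False infinite_iff_card_of_nat ordLeq_transitive by blast
  then have "|A \<times> (UNIV :: bool list set)| =o |A|"
    using card_of_Times_infinite[OF False] by blast
  then show ?thesis using assms ordIso_ordLess_trans by blast
qed

text \<open>One well-order of \<open>cantor\<close> indexes both the closed sets and the fibres. The
  choices of \<open>d x l\<close> do not depend on each other, so no transfinite recursion is
  involved.\<close>

lemma ex_dense_fibres_avoiding_thin:
  assumes "cov_meager =o continuum"
  obtains d :: "cantor \<Rightarrow> bool list \<Rightarrow> cantor"
  where "\<And>x l. d x l \<in> cylinder l"
    and "\<And>N. thin N \<Longrightarrow> |{(x, d x l) |x l. True} \<inter> N| <o cov_meager"
proof -
  \<comment> \<open>The cardinal order \<open>?r\<close> is itself a well-order of
    \<open>cantor\<close> whose proper initial segments have smaller cardinality.\<close>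
  let ?r = "|UNIV :: cantor set|"
  have cov: "cov_meager =o ?r"
    using assms card_cantor_ordLeq_continuum cov_meager_ordLeq_cantor
    by (meson ordIso_iff_ordLeq ordIso_symmetric ordLeq_ordIso_trans)
  have r: "Card_order ?r" "Field ?r = UNIV" "wo_rel ?r"
    using card_of_Card_order card_of_Well_order by (auto simp: Field_card_of wo_rel_def)
  have inf: "infinite (UNIV :: cantor set)"
    using uncountable_cylinder[of "[]"] countable_finite by (auto simp: cylinder_def)
  have small: "|insert a (underS ?r a)| <o ?r" for a
  proof -
    have "|{a}| <o ?r"
      using inf by (intro finite_ordLess_infinite card_of_Well_order) (simp_all add: Field_card_of)
    moreover have "|underS ?r a| <o ?r" using card_of_underS[OF r(1)] r(2) by blast
    ultimately show ?thesis
      using card_of_Un_ordLess_infinite[OF inf, of "{a}" "underS ?r a"] by simp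
  qed
  obtain N :: "cantor \<Rightarrow> (cantor \<times> cantor) set"
    where N: "\<forall>F. closed F \<longrightarrow> F \<in> range N"
    by (rule exE[OF closed_sets_enumeration])
  have "\<exists>y. y \<in> cylinder l \<and> (\<forall>a\<in>insert x (underS ?r x). thin (N a) \<longrightarrow> (x, y) \<notin> N a)" for x l
  proof -
    let ?I = "{a \<in> insert x (underS ?r x). thin (N a)}"
    have "|?I| \<le>o |insert x (underS ?r x)|" by (rule card_of_mono1) blast
    then have "|?I| <o cov_meager"
      using small ordLeq_ordLess_trans ordLess_ordIso_trans ordIso_symmetric[OF cov] by blast
    then have "\<exists>y\<in>cylinder l. \<forall>a\<in>?I. y \<notin> Pair x -` N a"
      by (rule cylinder_not_covered) (simp add: thin_fibre)
    then show ?thesis by auto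
  qed
  then have "\<exists>d. \<forall>x l. d x l \<in> cylinder l \<and>
      (\<forall>a\<in>insert x (underS ?r x). thin (N a) \<longrightarrow> (x, d x l) \<notin> N a)"
    by (intro choice allI)
  then obtain d where d: "\<And>x l. d x l \<in> cylinder l"
    "\<And>x l a. a \<in> insert x (underS ?r x) \<Longrightarrow> thin (N a) \<Longrightarrow> (x, d x l) \<notin> N a"
    by blast
  show ?thesis
  proof
    show "d x l \<in> cylinder l" for x l by (rule d)
    fix F assume F: "thin F"
    then obtain a where a: "F = N a" using N unfolding thin_def by blast
    have "{(x, d x l) |x l. True} \<inter> F \<subseteq> (\<lambda>(x, l). (x, d x l)) ` (underS ?r a \<times> UNIV)"
    proof
      fix p assume "p \<in> {(x, d x l) |x l. True} \<inter> F"
      then obtain x l where p: "p = (x, d x l)" "(x, d x l) \<in> N a" using a by blast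
      \<comment> \<open>Were \<open>a\<close> at most \<open>x\<close>, the choice of
        \<open>d x l\<close> would have avoided \<open>N a\<close>; hence \<open>x\<close> strictly
        precedes \<open>a\<close>.\<close>
      then have "a \<notin> insert x (underS ?r x)" using d(2) F a by blast
      then have "x \<in> underS ?r a"
        using wo_rel.TOTALS[OF r(3)] r(2) unfolding underS_def by auto
      then show "p \<in> (\<lambda>(x, l). (x, d x l)) ` (underS ?r a \<times> UNIV)" using p(1) by force
    qed
    then have "|{(x, d x l) |x l. True} \<inter> F| \<le>o |underS ?r a \<times> (UNIV :: bool list set)|"
      using card_of_mono1 card_of_image ordLeq_transitive by meson
    moreover have "|underS ?r a \<times> (UNIV :: bool list set)| <o ?r"
      using times_bool_lists_ordLess_cantor card_of_underS[OF r(1)] r(2) by blast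
    ultimately show "|{(x, d x l) |x l. True} \<inter> F| <o cov_meager"
      using ordLeq_ordLess_trans ordLess_ordIso_trans ordIso_symmetric[OF cov] by blast
  qed
qed

section \<open>The Menger property from dense fibres\<close>

text \<open>Compactness of the first factor makes the choice of the finite subfamily uniform in \<open>x\<close>.\<close>

lemma finite_subfamily_meets_fibres:
  assumes op: "\<And>U. U \<in> \<U> \<Longrightarrow> open U"
    and meets: "\<And>x :: cantor. \<exists>y\<in>cylinder l. (x, y) \<in> \<Union>\<U>"
  shows "\<exists>\<F>. finite \<F> \<and> \<F> \<subseteq> \<U> \<and> (\<forall>x. \<exists>y\<in>cylinder l. (x, y) \<in> \<Union>\<F>)"
proof -
  \<comment> \<open>Projections are open maps, so the sets \<open>G U\<close> form an open cover of
    the compact first factor.\<close>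
  define G where "G U = fst ` (U \<inter> UNIV \<times> cylinder l)" for U :: "(cantor \<times> cantor) set"
  have "open (G U)" if "U \<in> \<U>" for U
    unfolding G_def using op[OF that] open_cylinder by (intro open_image_fst) (auto intro: open_Times)
  moreover have "UNIV \<subseteq> (\<Union>U\<in>\<U>. G U)"
  proof
    fix x :: cantor
    obtain y U where "y \<in> cylinder l" "U \<in> \<U>" "(x, y) \<in> U" using meets by blast
    then show "x \<in> (\<Union>U\<in>\<U>. G U)" by (force simp: G_def)
  qed
  ultimately obtain \<F> where \<F>: "\<F> \<subseteq> \<U>" "finite \<F>" "UNIV \<subseteq> (\<Union>U\<in>\<F>. G U)"
    using compactE_image[OF compact_UNIV_cantor] by metis
  have "\<exists>y\<in>cylinder l. (x, y) \<in> \<Union>\<F>" for x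
  proof -
    obtain U where "U \<in> \<F>" "x \<in> G U" using \<F>(3) by blast
    then obtain y where "y \<in> cylinder l" "(x, y) \<in> U" by (auto simp: G_def)
    then show ?thesis using \<open>U \<in> \<F>\<close> by blast
  qed
  then show ?thesis using \<F> by blast
qed

lemma Menger_if_dense_fibres_avoiding_thin:
  assumes dense: "\<And>x l. \<exists>y\<in>cylinder l. (x, y) \<in> X"
    and small: "\<And>N. thin N \<Longrightarrow> |X \<inter> N| <o cov_meager"
  shows "Menger X"
  unfolding Menger_def
proof (intro allI impI)
  fix \<U> :: "nat \<Rightarrow> (cantor \<times> cantor) set set"
  assume cov: "\<forall>n. open_cover X (\<U> n)"
  \<comment> \<open>The \<open>n\<close>-th even cover handles the cylinder with code
    \<open>n\<close> over all \<open>x\<close> at once. Together the chosen sets are dense in every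
    fibre, which makes the complement of their union thin.\<close>
  have "\<exists>\<F>. finite \<F> \<and> \<F> \<subseteq> \<U> (2 * n) \<and> (\<forall>x. \<exists>y\<in>cylinder (from_nat n). (x, y) \<in> \<Union>\<F>)" for n
  proof (rule finite_subfamily_meets_fibres[of "\<U> (2 * n)" "from_nat n"])
    show "\<exists>y\<in>cylinder (from_nat n). (x, y) \<in> \<Union>(\<U> (2 * n))" for x
    proof -
      obtain y where "y \<in> cylinder (from_nat n)" "(x, y) \<in> X" using dense by blast
      moreover have "X \<subseteq> \<Union>(\<U> (2 * n))" using cov unfolding open_cover_def by blast
      ultimately show ?thesis by blast
    qed
  qed (use cov in \<open>auto simp: open_cover_def\<close>)
  then have "\<exists>\<F>. \<forall>n. finite (\<F> n) \<and> \<F> n \<subseteq> \<U> (2 * n) \<and>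
      (\<forall>x. \<exists>y\<in>cylinder (from_nat n). (x, y) \<in> \<Union>(\<F> n))"
    by (intro choice allI)
  then obtain \<F> where *: "\<forall>n. finite (\<F> n) \<and> \<F> n \<subseteq> \<U> (2 * n) \<and>
      (\<forall>x. \<exists>y\<in>cylinder (from_nat n). (x, y) \<in> \<Union>(\<F> n))"
    by (rule exE)
  have \<F>: "finite (\<F> n)" "\<F> n \<subseteq> \<U> (2 * n)"
    "\<exists>y\<in>cylinder (from_nat n). (x, y) \<in> \<Union>(\<F> n)" for n x
    by (simp_all only: *)
  define N where "N = - (\<Union>n. \<Union>(\<F> n))"
  have "thin N"
    unfolding thin_def
  proof (intro conjI allI)
    show "closed N"
    proof -
      have "open U" if "U \<in> \<F> n" for U n
        using that cov \<F>(2)[of n] unfolding open_cover_def by blast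
      then show ?thesis unfolding N_def by (intro closed_Compl open_UN open_Union ballI)
    qed
    show "interior (Pair x -` N) = {}" for x
      unfolding interior_eq_empty_cylinder
    proof
      fix l
      show "\<exists>y\<in>cylinder l. y \<notin> Pair x -` N"
        using \<F>(3)[of "to_nat l" x] by (auto simp: N_def)
    qed
  qed
  then have "Menger (X \<inter> N)" by (intro small_imp_Menger small)
  moreover have "\<forall>n. open_cover (X \<inter> N) (\<U> (2 * n + 1))"
    using cov by (auto simp: open_cover_def)
  ultimately have "\<exists>\<G>. (\<forall>n. finite (\<G> n) \<and> \<G> n \<subseteq> \<U> (2 * n + 1)) \<and> X \<inter> N \<subseteq> (\<Union>n. \<Union>(\<G> n))"
    unfolding Menger_def by (elim allE[where x = "\<lambda>n. \<U> (2 * n + 1)"] mp)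
  then obtain \<G> where \<G>: "\<And>n. finite (\<G> n) \<and> \<G> n \<subseteq> \<U> (2 * n + 1)"
    "X \<inter> N \<subseteq> (\<Union>n. \<Union>(\<G> n))"
    by blast
  define \<H> where "\<H> n = (if even n then \<F> (n div 2) else \<G> (n div 2))" for n
  have "finite (\<H> n) \<and> \<H> n \<subseteq> \<U> n" for n
    using \<F>(1,2)[of "n div 2"] \<G>(1)[of "n div 2"] by (auto simp: \<H>_def)
  moreover have "X \<subseteq> (\<Union>n. \<Union>(\<H> n))"
  proof -
    have "\<F> n = \<H> (2 * n)" "\<G> n = \<H> (2 * n + 1)" for n by (auto simp: \<H>_def)
    then have *: "\<Union>(\<F> n) \<subseteq> (\<Union>n. \<Union>(\<H> n))" "\<Union>(\<G> n) \<subseteq> (\<Union>n. \<Union>(\<H> n))" for n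
      by (metis UN_upper UNIV_I)+
    have sub: "(\<Union>n. \<Union>(\<F> n)) \<subseteq> (\<Union>n. \<Union>(\<H> n))" "(\<Union>n. \<Union>(\<G> n)) \<subseteq> (\<Union>n. \<Union>(\<H> n))"
      by (intro UN_least *)+
    show ?thesis
    proof
      fix p assume p: "p \<in> X"
      show "p \<in> (\<Union>n. \<Union>(\<H> n))"
      proof (cases "p \<in> N")
        case True
        then have "p \<in> (\<Union>n. \<Union>(\<G> n))" using p \<G>(2) by (simp only: subset_iff Int_iff)
        then show ?thesis by (rule subsetD[OF sub(2)])
      next
        case False
        then have "p \<in> (\<Union>n. \<Union>(\<F> n))" by (simp only: N_def Compl_iff not_not)
        then show ?thesis by (rule subsetD[OF sub(1)])
      qed
    qed
  qed
  ultimately show "\<exists>\<F>. (\<forall>n. finite (\<F> n) \<and> \<F> n \<subseteq> \<U> n) \<and> X \<subseteq> (\<Union>n. \<Union>(\<F> n))"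
    by (intro exI[of _ \<H>] conjI allI) (simp_all only:)
qed

section \<open>Total imperfectness\<close>

text \<open>A copy of the Cantor space in \<open>X\<close> is closed, and its countable fibres
  contain no cylinder; being thin it would have fewer than cov(M) points, yet it has as many as
  \<open>cantor\<close>.\<close>

lemma totally_imperfect_if_countable_fibres:
  assumes fibres: "\<And>x. countable (Pair x -` X)"
    and small: "\<And>N. thin N \<Longrightarrow> |X \<inter> N| <o cov_meager"
  shows "totally_imperfect X"
  unfolding totally_imperfect_def
proof
  assume "\<exists>P\<subseteq>X. P homeomorphic (UNIV :: cantor set)"
  then obtain P where P: "P \<subseteq> X" "P homeomorphic (UNIV :: cantor set)" by blast
  have "compact P" using homeomorphic_compactness[OF P(2)] compact_UNIV_cantor by simp
  then have "closed P"
    using compactin_imp_closedin[OF Hausdorff_cantor_times_cantor, of P] by simp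
  moreover have "interior (Pair x -` P) = {}" for x
  proof -
    have "countable (Pair x -` P)"
      using fibres[of x] P(1) by (meson countable_subset vimage_mono)
    then have "\<not> cylinder l \<subseteq> Pair x -` P" for l
      using uncountable_cylinder countable_subset by blast
    then show ?thesis unfolding interior_eq_empty_cylinder by blast
  qed
  ultimately have "|X \<inter> P| <o cov_meager" by (intro small) (simp add: thin_def)
  then have "|P| <o cov_meager" using P(1) by (simp add: Int_absorb1)
  moreover have "|UNIV :: cantor set| \<le>o |P|"
  proof -
    obtain f g where "homeomorphism P (UNIV :: cantor set) f g"
      using P(2) unfolding homeomorphic_def by blast
    then have "f ` P = UNIV" by (simp add: homeomorphism_def)
    then show ?thesis using card_of_image[of f P] by simp
  qed
  ultimately show False
    using cov_meager_ordLeq_cantor ordLeq_transitive not_ordLess_ordLeq by blast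
qed

section \<open>Failure of S1(\<Gamma>, O)\<close>

text \<open>For fixed \<open>n\<close> every point is missed by at most one \<open>V n m\<close>,
  which gives a \<gamma>-cover. A selection \<open>h\<close> leaves uncovered every point over a
  \<open>c\<close> whose first true entry in each row \<open>n\<close> is in column
  \<open>h n\<close>.\<close>

lemma not_S1_Gamma_O_if_full_projection:
  fixes X :: "(cantor \<times> 'a::topological_space) set"
  assumes "fst ` X = UNIV"
  shows "\<not> S1_Gamma_O X"
proof
  assume S1: "S1_Gamma_O X"
  define V where "V n m = - (first_true n m \<times> (UNIV :: 'a set))" for n m
  have "open_gamma_cover X (range (V n))" for n
  proof -
    have "finite (- {m. p \<in> V n m})" for p
    proof -
      have "- {m. p \<in> V n m} = {m. fst p \<in> first_true n m}"
        by (auto simp: V_def mem_Times_iff)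
      then show ?thesis using finite_first_true by simp
    qed
    moreover have "open (V n m)" for m
      unfolding V_def by (intro open_Compl closed_Times clopen_first_true closed_UNIV)
    ultimately show ?thesis unfolding open_gamma_cover_def gamma_cover_def by blast
  qed
  then have "\<exists>U. (\<forall>n. U n \<in> range (V n)) \<and> X \<subseteq> (\<Union>n. U n)"
    using S1 unfolding S1_Gamma_O_def by (elim allE[where x = "\<lambda>n. range (V n)"] mp) blast
  then obtain U where U: "\<And>n. U n \<in> range (V n)" "X \<subseteq> (\<Union>n. U n)" by blast
  have "\<exists>h. \<forall>n. U n = V n (h n)" using U(1) by (intro choice allI) blast
  then obtain h where h: "\<And>n. U n = V n (h n)" by blast
  obtain c where c: "\<And>n. c \<in> first_true n (h n)" using ex_all_first_true by blast
  obtain y where "(c, y) \<in> X" using assms by (metis UNIV_I imageE prod.collapse)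
  then show False using U(2) h c by (auto simp: V_def)
qed

theorem corollary3p4:
  assumes "cov_meager =o continuum"
  shows "(\<exists>X :: cantor set. Menger X \<and> totally_imperfect X \<and> \<not> S1_Gamma_O X) \<or>
         (\<exists>X :: (cantor \<times> cantor) set. Menger X \<and> totally_imperfect X \<and> \<not> S1_Gamma_O X)"
proof -
  obtain d :: "cantor \<Rightarrow> bool list \<Rightarrow> cantor"
    where d: "\<And>x l. d x l \<in> cylinder l"
      and small: "\<And>N. thin N \<Longrightarrow> |{(x, d x l) |x l. True} \<inter> N| <o cov_meager"
    using ex_dense_fibres_avoiding_thin[OF assms] by blast
  \<comment> \<open>The set lies in the product, so the second alternative is the one
    established.\<close>
  let ?X = "{(x, d x l) |x l. True}"
  have "Menger ?X"
    using d by (intro Menger_if_dense_fibres_avoiding_thin small) blast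
  moreover have "totally_imperfect ?X"
  proof (intro totally_imperfect_if_countable_fibres small)
    have "Pair x -` ?X = range (d x)" for x by auto
    then show "countable (Pair x -` ?X)" for x by simp
  qed
  moreover have "x \<in> fst ` ?X" for x by (rule image_eqI[of _ _ "(x, d x [])"]) auto
  then have "fst ` ?X = UNIV" by blast
  then have "\<not> S1_Gamma_O ?X" by (rule not_S1_Gamma_O_if_full_projection)
  ultimately show ?thesis by blast
qed

end
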